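(* The sets $\mathrm{SPP}(n)$ and $\mathrm{SPP}_{\mathbb{R}_+}(n)$ for $n\le 4$ have the following values: \begin{align*} \mathrm{SPP}_{\mathbb{R}_+}(1) &= \mathrm{SPP}(1) = \{(1,1)\},\\ \mathrm{SPP}_{\mathbb{R}_+}(2) &= \mathrm{SPP}(2) = \{(3,3)\},\\ \mathrm{SPP}_{\mathbb{R}_+}(3) &= \mathrm{SPP}(3) = \{(5,6),(6,5),(6,6)\},\\ \mathrm{SPP}(4) &= \{(i,j) : 7\le i\le 10,\ 9\le j\le 10\}\cup\{(10,7),(10,8)\},\\ \mathrm{SPP}_{\mathbb{R}_+}(4) &= \mathrm{SPP}(4)\cup\{(9,7),(9,8)\}, \end{align*} where $i,j$ denote integers.
   Context: For a finite set $A$ of real numbers, $A+A=\{x+y : x,y\in A\}$ and $AA=\{xy : x,y\in A\}$ (here $x=y$ is allowed). For a set $X$ of real numbers and a positive integer $n$, define the set of sum-product pairs $\mathrm{SPP}_X(n)=\{(|A+A|,|AA|) : A\subseteq X,\ |A|=n\}$. Write $\mathrm{SPP}(n)=\mathrm{SPP}_{\mathbb{N}}(n)$, where $\mathbb{N}$ is the set of positive integers, and let $\mathbb{R}_+$ be the set of positive real numbers. *)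

theory Defs
  imports Complex_Main "HOL-Library.Set_Algebras"
begin

text \<open>
  On sets, \<open>A + A\<close> and \<open>A * A\<close> are the elementwise operations of
  \<^theory>\<open>HOL-Library.Set_Algebras\<close>, i.e. the sumset and the product set
  (both summands or factors may be the same element).
\<close>

definition SPP_in :: "real set \<Rightarrow> nat \<Rightarrow> (nat \<times> nat) set" where
  "SPP_in X n = {(card (A + A), card (A * A)) |A. A \<subseteq> X \<and> finite A \<and> card A = n}"

definition SPP :: "nat \<Rightarrow> (nat \<times> nat) set" where
  "SPP n = SPP_in {real k |k. k > 0} n"

definition SPP_pos_real :: "nat \<Rightarrow> (nat \<times> nat) set" where
  "SPP_pos_real n = SPP_in {x. x > 0} n"

end

theory Submission
  imports Defs
begin

text \<open>
  For \<open>0 < a < b < c < d\<close> only five pairs among the ten sums can coincide, and each coincidence lowers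
  \<open>|A + A|\<close> by one; the logarithm transfers this to products. Two or more product
  coincidences force the set, up to scaling, to be \<open>{1, r, r\<^sup>2, r\<^sup>3}\<close>, \<open>{1, r, r\<^sup>2, r\<^sup>4}\<close> or
  \<open>{1, r\<^sup>2, r\<^sup>3, r\<^sup>4}\<close> with \<open>r > 1\<close>. After cancelling the factor \<open>r - 1\<close>, a sum coincidence in such a
  set means that \<open>r\<close> is a root of \<open>x\<^sup>2 - x - 1\<close>, \<open>x\<^sup>3 - x - 1\<close> or \<open>x\<^sup>3 - x\<^sup>2 - x - 1\<close>. No two of these
  share a root \<open>r > 1\<close>, so at most one sum coincidence occurs, and none occurs for rational \<open>r\<close>. The
  golden ratio realises the two pairs that integers miss.
\<close>

section \<open>Sumsets of ordered triples and quadruples\<close>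

definition sum_coincidences :: "real \<Rightarrow> real \<Rightarrow> real \<Rightarrow> real \<Rightarrow> nat" where
  "sum_coincidences a b c d =
    of_bool (a + c = b + b) + of_bool (a + d = b + b) + of_bool (a + d = b + c) +
    of_bool (a + d = c + c) + of_bool (b + d = c + c)"

definition prod_coincidences :: "real \<Rightarrow> real \<Rightarrow> real \<Rightarrow> real \<Rightarrow> nat" where
  "prod_coincidences a b c d =
    of_bool (a * c = b * b) + of_bool (a * d = b * b) + of_bool (a * d = b * c) +
    of_bool (a * d = c * c) + of_bool (b * d = c * c)"

text \<open>Of the six sums, only \<open>a + c\<close> and \<open>b + b\<close> fall into a common
  gap, the one between \<open>a + b\<close> and \<open>b + c\<close>.\<close>

lemma card_sumset_3:
  fixes a b c :: real
  assumes "a < b" "b < c"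
  shows "card ({a, b, c} + {a, b, c}) = 6 - of_bool (a + c = b + b)"
proof -
  have "{a, b, c} + {a, b, c} = {a + a, a + b, b + c, c + c, a + c, b + b}"
    by (auto simp: set_plus_def add.commute)
  then show ?thesis
    using assms by (cases "a + c = b + b") (simp_all add: card_insert_if)
qed

text \<open>The seven sums in \<open>?P\<close> increase strictly as listed, so only
  \<open>b + b\<close>, \<open>b + c\<close> and \<open>c + c\<close> can be absorbed.\<close>

lemma card_sumset_4:
  fixes a b c d :: real
  assumes "a < b" "b < c" "c < d"
  shows "card ({a, b, c, d} + {a, b, c, d}) = 10 - sum_coincidences a b c d"
proof -
  let ?P = "{a + a, a + b, a + c, a + d, b + d, c + d, d + d}"
  have "{a, b, c, d} + {a, b, c, d} = insert (b + b) (insert (b + c) (insert (c + c) ?P))"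
    by (auto simp: set_plus_def add.commute)
  moreover have "card ?P = 7"
    using assms by simp
  moreover have "b + b \<in> ?P \<longleftrightarrow> a + c = b + b \<or> a + d = b + b"
    "b + c \<in> ?P \<longleftrightarrow> a + d = b + c" "c + c \<in> ?P \<longleftrightarrow> a + d = c + c \<or> b + d = c + c"
    using assms by auto
  \<comment> \<open>Each of the three remaining sums meets at most one element of \<open>?P\<close>,
    so the number of absorbed sums is the number of true equations.\<close>
  moreover have "b + b \<noteq> b + c" "b + b \<noteq> c + c" "b + c \<noteq> c + c"
    "\<not> (a + c = b + b \<and> a + d = b + b)" "\<not> (a + d = c + c \<and> b + d = c + c)"
    using assms by auto
  ultimately show ?thesis
    unfolding sum_coincidences_def
    by (simp only: card_insert_if insert_iff finite_insert finite.emptyI simp_thms) auto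
qed

section \<open>Transfer to products by the logarithm\<close>

lemma card_prodset_eq_card_ln_sumset:
  fixes A :: "real set"
  assumes "A \<subseteq> {0<..}"
  shows "card (A * A) = card (ln ` A + ln ` A)"
proof -
  have "ln ` (A * A) = ln ` A + ln ` A"
  proof safe
    fix z assume "z \<in> A * A"
    then obtain x y where "z = x * y" "x \<in> A" "y \<in> A"
      by (auto simp: set_times_def)
    then show "ln z \<in> ln ` A + ln ` A"
      using assms by (auto simp: ln_mult set_plus_def subset_iff)
  next
    fix z assume "z \<in> ln ` A + ln ` A"
    then obtain x y where xy: "x \<in> A" "y \<in> A" "z = ln x + ln y"
      by (auto simp: set_plus_def)
    then have "z = ln (x * y)"
      using assms by (auto simp: ln_mult subset_iff)
    with xy show "z \<in> ln ` (A * A)"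
      by blast
  qed
  moreover have "inj_on ln (A * A)"
    using assms by (auto simp: inj_on_def set_times_def subset_iff)
  ultimately show ?thesis
    by (metis card_image)
qed

lemma ln_add_eq_iff:
  fixes x y z w :: real
  assumes "0 < x" "0 < y" "0 < z" "0 < w"
  shows "ln x + ln y = ln z + ln w \<longleftrightarrow> x * y = z * w"
  using assms by (simp flip: ln_mult_pos)

lemma ln_add_eq_double_iff:
  fixes x y z :: real
  assumes "0 < x" "0 < y" "0 < z"
  shows "ln x + ln y = 2 * ln z \<longleftrightarrow> x * y = z * z"
  using assms ln_add_eq_iff[of x y z z] by simp

lemma prod_coincidences_eq_sum_coincidences_ln:
  assumes "0 < a" "0 < b" "0 < c" "0 < d"
  shows "prod_coincidences a b c d = sum_coincidences (ln a) (ln b) (ln c) (ln d)"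
  using assms
  by (simp add: sum_coincidences_def prod_coincidences_def ln_add_eq_iff ln_add_eq_double_iff)

lemma card_prodset_3:
  fixes a b c :: real
  assumes "0 < a" "a < b" "b < c"
  shows "card ({a, b, c} * {a, b, c}) = 6 - of_bool (a * c = b * b)"
  using assms card_sumset_3[of "ln a" "ln b" "ln c"]
  by (simp add: card_prodset_eq_card_ln_sumset ln_add_eq_double_iff)

lemma card_prodset_4:
  fixes a b c d :: real
  assumes "0 < a" "a < b" "b < c" "c < d"
  shows "card ({a, b, c, d} * {a, b, c, d}) = 10 - prod_coincidences a b c d"
  using assms card_sumset_4[of "ln a" "ln b" "ln c" "ln d"]
  by (simp add: card_prodset_eq_card_ln_sumset prod_coincidences_eq_sum_coincidences_ln)

section \<open>Sorted enumeration of small sets\<close>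

lemma finite_card_SucE:
  fixes A :: "'a :: linorder set"
  assumes "finite A" "card A = Suc n"
  obtains a B where "A = insert a B" "finite B" "card B = n" "\<forall>x\<in>B. a < x"
proof
  have "A \<noteq> {}"
    using assms by auto
  then show "A = insert (Min A) (A - {Min A})"
    using assms Min_in by blast
  show "finite (A - {Min A})"
    using assms by simp
  show "card (A - {Min A}) = n"
    using assms \<open>A \<noteq> {}\<close> by simp
  show "\<forall>x\<in>A - {Min A}. Min A < x"
    using assms by (auto simp: order.strict_iff_order)
qed

lemma card_3_sortedE:
  fixes A :: "'a :: linorder set"
  assumes "finite A" "card A = 3"
  obtains a b c where "A = {a, b, c}" "a < b" "b < c"
proof -
  have "card A = Suc 2"
    using assms by simp
  with assms obtain a B where B: "A = insert a B" "finite B" "card B = 2" "\<forall>x\<in>B. a < x"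
    by (metis finite_card_SucE)
  then obtain b c where "B = {b, c}" "b \<noteq> c"
    by (auto simp: card_2_iff)
  with B that[of a b c] that[of a c b] show thesis
    by (cases b c rule: linorder_cases) auto
qed

lemma card_4_sortedE:
  fixes A :: "'a :: linorder set"
  assumes "finite A" "card A = 4"
  obtains a b c d where "A = {a, b, c, d}" "a < b" "b < c" "c < d"
proof -
  have "card A = Suc 3"
    using assms by simp
  with assms obtain a B where B: "A = insert a B" "finite B" "card B = 3" "\<forall>x\<in>B. a < x"
    by (metis finite_card_SucE)
  then obtain b c d where "B = {b, c, d}" "b < c" "c < d"
    by (metis card_3_sortedE)
  with B show thesis
    using that[of a b c d] by simp
qed

section \<open>Pairs as coincidence counts\<close>

lemma SPP_inI:
  assumes "A \<subseteq> X" "finite A" "card A = n" "p = (card (A + A), card (A * A))"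
  shows "p \<in> SPP_in X n"
  using assms unfolding SPP_in_def by blast

text \<open>The witness \<open>A\<close> ensures that \<open>X\<close> has an
  \<open>n\<close>-element subset; otherwise there would be no pair at all.\<close>

lemma SPP_in_eq_singleton:
  assumes "A \<subseteq> X" "finite A" "card A = n"
    and "\<And>A. \<lbrakk>A \<subseteq> X; card A = n\<rbrakk> \<Longrightarrow> (card (A + A), card (A * A)) = p"
  shows "SPP_in X n = {p}"
proof
  show "SPP_in X n \<subseteq> {p}"
    unfolding SPP_in_def using assms(4) by auto
  show "{p} \<subseteq> SPP_in X n"
    using SPP_inI[OF assms(1-3)] assms(4)[OF assms(1,3)] by simp
qed

lemma SPP_in_1:
  assumes "a \<in> X"
  shows "SPP_in X 1 = {(1, 1)}"
proof -
  have "{x} + {x} = {x + x}" "{x} * {x} = {x * x}" for x :: real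
    by (auto simp: set_plus_def set_times_def)
  then have "(card (A + A), card (A * A)) = (1, 1)" if "card A = 1" for A :: "real set"
    using that by (auto simp: card_1_singleton_iff)
  moreover have "{a} \<subseteq> X" "finite {a}" "card {a} = 1"
    using assms by auto
  ultimately show ?thesis
    by (intro SPP_in_eq_singleton)
qed

lemma SPP_in_2:
  assumes "X \<subseteq> {0<..}" "a \<in> X" "b \<in> X" "a \<noteq> b"
  shows "SPP_in X 2 = {(3, 3)}"
proof -
  have sum: "card ({x, y} + {x, y}) = 3" if "x \<noteq> y" for x y :: real
  proof -
    have "{x, y} + {x, y} = {x + x, x + y, y + y}"
      by (auto simp: set_plus_def add.commute)
    with that show ?thesis
      by simp
  qed
  \<comment> \<open>Positivity matters: for \<open>y = - x\<close> the products \<open>x * x\<close>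
    and \<open>y * y\<close> agree.\<close>
  have prod: "card ({x, y} * {x, y}) = 3" if "x \<noteq> y" "0 < x" "0 < y" for x y :: real
    using that sum[of "ln x" "ln y"] by (simp add: card_prodset_eq_card_ln_sumset)
  have "(card (A + A), card (A * A)) = (3, 3)" if "A \<subseteq> X" "card A = 2" for A
  proof -
    from \<open>card A = 2\<close> obtain x y where "A = {x, y}" "x \<noteq> y"
      by (auto simp: card_2_iff)
    with that assms(1) show ?thesis
      using sum[of x y] prod[of x y] by auto
  qed
  moreover have "{a, b} \<subseteq> X" "finite {a, b}" "card {a, b} = 2"
    using assms by auto
  ultimately show ?thesis
    by (intro SPP_in_eq_singleton)
qed

lemma SPP_in_3:
  assumes "X \<subseteq> {0<..}"
  shows "SPP_in X 3 = {(6 - of_bool (a + c = b + b), 6 - of_bool (a * c = b * b)) |a b c.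
    a \<in> X \<and> b \<in> X \<and> c \<in> X \<and> a < b \<and> b < c}" (is "_ = ?R")
proof (intro equalityI subsetI)
  fix p assume "p \<in> SPP_in X 3"
  then obtain A where A: "p = (card (A + A), card (A * A))" "A \<subseteq> X" "finite A" "card A = 3"
    by (auto simp: SPP_in_def)
  obtain a b c where "A = {a, b, c}" "a < b" "b < c"
    using A card_3_sortedE by blast
  moreover from this have "a \<in> X" "b \<in> X" "c \<in> X"
    using A by auto
  moreover have "0 < a"
    using assms \<open>a \<in> X\<close> by auto
  ultimately have "p = (6 - of_bool (a + c = b + b), 6 - of_bool (a * c = b * b))"
    using A by (simp add: card_sumset_3 card_prodset_3)
  then show "p \<in> ?R"
    using \<open>a \<in> X\<close> \<open>b \<in> X\<close> \<open>c \<in> X\<close> \<open>a < b\<close> \<open>b < c\<close> by blast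
next
  fix p assume "p \<in> ?R"
  then obtain a b c where p: "p = (6 - of_bool (a + c = b + b), 6 - of_bool (a * c = b * b))"
    and abc: "a \<in> X" "b \<in> X" "c \<in> X" "a < b" "b < c"
    by blast
  then have "0 < a"
    using assms by auto
  with p abc have "p = (card ({a, b, c} + {a, b, c}), card ({a, b, c} * {a, b, c}))"
    by (simp add: card_sumset_3 card_prodset_3)
  moreover have "{a, b, c} \<subseteq> X" "finite {a, b, c}" "card {a, b, c} = 3"
    using abc by auto
  ultimately show "p \<in> SPP_in X 3"
    by (intro SPP_inI)
qed

text \<open>Sorting a four-element set reduces membership to the two counts. Neither count exceeds 3
  for positive sorted elements, so the natural-number subtractions never truncate.\<close>

lemma SPP_in_4:
  assumes "X \<subseteq> {0<..}"
  shows "SPP_in X 4 = {(10 - sum_coincidences a b c d, 10 - prod_coincidences a b c d) |a b c d.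
    a \<in> X \<and> b \<in> X \<and> c \<in> X \<and> d \<in> X \<and> a < b \<and> b < c \<and> c < d}" (is "_ = ?R")
proof (intro equalityI subsetI)
  fix p assume "p \<in> SPP_in X 4"
  then obtain A where A: "p = (card (A + A), card (A * A))" "A \<subseteq> X" "finite A" "card A = 4"
    by (auto simp: SPP_in_def)
  obtain a b c d where "A = {a, b, c, d}" "a < b" "b < c" "c < d"
    using A card_4_sortedE by blast
  moreover from this have "a \<in> X" "b \<in> X" "c \<in> X" "d \<in> X"
    using A by auto
  moreover have "0 < a"
    using assms \<open>a \<in> X\<close> by auto
  ultimately have "p = (10 - sum_coincidences a b c d, 10 - prod_coincidences a b c d)"
    using A by (simp add: card_sumset_4 card_prodset_4)
  then show "p \<in> ?R"
    using \<open>a \<in> X\<close> \<open>b \<in> X\<close> \<open>c \<in> X\<close> \<open>d \<in> X\<close> \<open>a < b\<close> \<open>b < c\<close> \<open>c < d\<close> by blast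
next
  fix p assume "p \<in> ?R"
  then obtain a b c d
    where p: "p = (10 - sum_coincidences a b c d, 10 - prod_coincidences a b c d)"
    and abcd: "a \<in> X" "b \<in> X" "c \<in> X" "d \<in> X" "a < b" "b < c" "c < d"
    by blast
  then have "0 < a"
    using assms by auto
  with p abcd have "p = (card ({a, b, c, d} + {a, b, c, d}), card ({a, b, c, d} * {a, b, c, d}))"
    by (simp add: card_sumset_4 card_prodset_4)
  moreover have "{a, b, c, d} \<subseteq> X" "finite {a, b, c, d}" "card {a, b, c, d} = 4"
    using abcd by auto
  ultimately show "p \<in> SPP_in X 4"
    by (intro SPP_inI)
qed

section \<open>Sets with several coincidences\<close>

text \<open>Since \<open>b + b < b + c < c + c\<close>, at most one of the three equations with left
  side \<open>a + d\<close> holds.\<close>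

lemma sum_coincidences_le_3:
  assumes "a < b" "b < c" "c < d"
  shows "sum_coincidences a b c d \<le> 3"
  using assms unfolding sum_coincidences_def
  by (cases "a + c = b + b"; cases "a + d = b + b"; cases "a + d = b + c";
      cases "a + d = c + c"; cases "b + d = c + c") simp_all

text \<open>Any two of \<open>a + c = b + b\<close>, \<open>a + d = b + c\<close>,
  \<open>b + d = c + c\<close> imply the third and give the first disjunct. Of the other pairs only
  the two listed are consistent.\<close>

lemma two_sum_coincidences_cases:
  assumes "a < b" "b < c" "c < d" "2 \<le> sum_coincidences a b c d"
  shows "a + c = b + b \<and> b + d = c + c \<or> a + c = b + b \<and> a + d = c + c \<or>
    a + d = b + b \<and> b + d = c + c"
  using assms unfolding sum_coincidences_def
  by (cases "a + c = b + b"; cases "a + d = b + b"; cases "a + d = b + c";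
      cases "a + d = c + c"; cases "b + d = c + c") simp_all

text \<open>The digits in the case names are the exponents of \<open>r\<close>. The cases that allow
  a sum coincidence record \<open>r = d / c\<close>, so that integer elements make \<open>r\<close>
  rational.\<close>

lemma two_prod_coincidences_cases:
  assumes "0 < a" "a < b" "b < c" "c < d" "2 \<le> prod_coincidences a b c d"
  obtains (powers_0123) r where "r = d / c" "1 < r" "b = a * r" "c = a * r^2" "d = a * r^3"
    | (powers_0124) r where "1 < r" "b = a * r" "c = a * r^2" "d = a * r^4"
    | (powers_0234) r where "r = d / c" "1 < r" "b = a * r^2" "c = a * r^3" "d = a * r^4"
proof -
  have "a * c = b * b \<and> b * d = c * c \<or> a * c = b * b \<and> a * d = c * c \<or>
      a * d = b * b \<and> b * d = c * c"
    using assms two_sum_coincidences_cases[of "ln a" "ln b" "ln c" "ln d"]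
    by (simp add: prod_coincidences_eq_sum_coincidences_ln ln_add_eq_double_iff)
  then consider "a * c = b * b" "b * d = c * c" | "a * c = b * b" "a * d = c * c"
    | "a * d = b * b" "b * d = c * c"
    by blast
  then show thesis
  proof cases
    case 1
    define r where "r = b / a"
    have b: "b = a * r"
      using assms by (simp add: r_def)
    have c: "c = a * r^2"
      using 1(1) assms(1) by (simp add: b power2_eq_square)
    have d: "d = a * r^3"
      using 1(2) assms by (simp add: b c power2_eq_square power3_eq_cube)
    have "1 < r"
      using assms by (simp add: r_def)
    moreover have "r = d / c"
      using assms(1) \<open>1 < r\<close> by (simp add: c d power2_eq_square power3_eq_cube)
    ultimately show thesis
      using powers_0123 b c d by blast
  next
    case 2
    define r where "r = b / a"
    have b: "b = a * r"
      using assms by (simp add: r_def)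
    have c: "c = a * r^2"
      using 2(1) assms(1) by (simp add: b power2_eq_square)
    have d: "d = a * r^4"
      using 2(2) assms by (simp add: c power2_eq_square power4_eq_xxxx)
    have "1 < r"
      using assms by (simp add: r_def)
    then show thesis
      using powers_0124 b c d by blast
  next
    case 3
    \<comment> \<open>Here \<open>b / a\<close> is the square of the ratio, so \<open>r\<close> is
      read off at the upper end, which avoids a square root.\<close>
    define r where "r = d / c"
    have d: "d = c * r"
      using assms by (simp add: r_def)
    have c: "c = b * r"
      using 3(2) assms by (simp add: d)
    have "a * (r * r) = b"
      using 3(1) assms by (simp add: c d)
    then have b: "b = a * r^2"
      by (simp add: power2_eq_square)
    have "1 < r"
      using assms by (simp add: r_def)
    moreover have "c = a * r^3" "d = a * r^4"
      by (simp_all add: d c b power2_eq_square power3_eq_cube power4_eq_xxxx)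
    ultimately show thesis
      using powers_0234 r_def b by blast
  qed
qed

section \<open>Sum coincidences in sets of powers\<close>

text \<open>The five equations are homogeneous, so the smallest element can be normalised to
  1.\<close>

lemma sum_coincidences_mult:
  assumes "0 < a"
  shows "sum_coincidences (a * p) (a * q) (a * s) (a * t) = sum_coincidences p q s t"
  using assms by (simp add: sum_coincidences_def flip: distrib_left)

text \<open>After division by \<open>r - 1\<close>, every quotient except \<open>r^2 - r - 1\<close>
  is positive for \<open>r > 1\<close>.\<close>

lemma sum_coincidences_0123:
  assumes "1 < r"
  shows "sum_coincidences 1 r (r^2) (r^3) = of_bool (r^2 = r + 1)"
proof -
  \<comment> \<open>Every difference of sides vanishes at \<open>r = 1\<close>; this fact cancels
    the factor, leaving only a polynomial identity to check.\<close>
  have *: "x - y = (r - 1) * q \<Longrightarrow> x = y \<longleftrightarrow> q = 0" for x y q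
    using assms by auto
  have pos: "0 < r^2" "0 < r^3" using assms by auto
  have "1 + r^2 = r + r \<longleftrightarrow> r - 1 = 0"
    by (rule *) algebra
  moreover have "1 + r^3 = r + r \<longleftrightarrow> r^2 + r - 1 = 0"
    by (rule *) algebra
  moreover have "1 + r^3 = r + r^2 \<longleftrightarrow> (r - 1) * (r + 1) = 0"
    by (rule *) algebra
  moreover have "1 + r^3 = r^2 + r^2 \<longleftrightarrow> r^2 - r - 1 = 0"
    by (rule *) algebra
  moreover have "r + r^3 = r^2 + r^2 \<longleftrightarrow> (r - 1) * r = 0"
    by (rule *) algebra
  ultimately show ?thesis
    using assms pos by (auto simp: sum_coincidences_def)
qed

text \<open>All five quotients by \<open>r - 1\<close> are positive for
  \<open>r > 1\<close>.\<close>

lemma sum_coincidences_0124: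
  assumes "1 < r"
  shows "sum_coincidences 1 r (r^2) (r^4) = 0"
proof -
  have *: "x - y = (r - 1) * q \<Longrightarrow> x = y \<longleftrightarrow> q = 0" for x y q
    using assms by auto
  have pos: "0 < r^2" "0 < r^3" using assms by auto
  have "1 + r^2 = r + r \<longleftrightarrow> r - 1 = 0"
    by (rule *) algebra
  moreover have "1 + r^4 = r + r \<longleftrightarrow> r^3 + r^2 + r - 1 = 0"
    by (rule *) algebra
  moreover have "1 + r^4 = r + r^2 \<longleftrightarrow> r^3 + r^2 - 1 = 0"
    by (rule *) algebra
  moreover have "1 + r^4 = r^2 + r^2 \<longleftrightarrow> (r - 1) * (r + 1)^2 = 0"
    by (rule *) algebra
  moreover have "r + r^4 = r^2 + r^2 \<longleftrightarrow> r * (r^2 + r - 1) = 0"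
    by (rule *) algebra
  moreover have "1 < r^2" using assms by simp
  ultimately show ?thesis
    using assms pos by (auto simp: sum_coincidences_def)
qed

text \<open>Three quotients by \<open>r - 1\<close> can vanish beyond 1. Their mutual exclusion is
  left to the next lemma.\<close>

lemma sum_coincidences_0234:
  assumes "1 < r"
  shows "sum_coincidences 1 (r^2) (r^3) (r^4) =
    of_bool (r^2 = r + 1) + of_bool (r^3 = r + 1) + of_bool (r^3 = r^2 + r + 1)"
proof -
  have *: "x - y = (r - 1) * q \<Longrightarrow> x = y \<longleftrightarrow> q = 0" for x y q
    using assms by auto
  have pos: "0 < r^2" "0 < r^3" using assms by auto
  have "1 + r^3 = r^2 + r^2 \<longleftrightarrow> r^2 - r - 1 = 0"
    by (rule *) algebra
  moreover have "1 + r^4 = r^2 + r^2 \<longleftrightarrow> (r - 1) * (r + 1)^2 = 0"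
    by (rule *) algebra
  moreover have "1 + r^4 = r^2 + r^3 \<longleftrightarrow> r^3 - r - 1 = 0"
    by (rule *) algebra
  moreover have "1 + r^4 = r^3 + r^3 \<longleftrightarrow> r^3 - r^2 - r - 1 = 0"
    by (rule *) algebra
  moreover have "r^2 + r^4 = r^3 + r^3 \<longleftrightarrow> (r - 1) * r^2 = 0"
    by (rule *) algebra
  ultimately show ?thesis
    using assms pos by (auto simp: sum_coincidences_def)
qed

text \<open>The equation for \<open>r\<close> is kept in the conclusion because rationality of
  \<open>d / c\<close> can then refute the second alternative.\<close>

lemma prod_coincidences_ge_2_imp:
  assumes "0 < a" "a < b" "b < c" "c < d" "2 \<le> prod_coincidences a b c d" "r = d / c"
  shows "sum_coincidences a b c d = 0 \<or> sum_coincidences a b c d = 1 \<and>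
    (r^2 = r + 1 \<or> r^3 = r + 1 \<or> r^3 = r^2 + r + 1)"
  using assms(1-5)
proof (cases rule: two_prod_coincidences_cases)
  case (powers_0123 s)
  have "sum_coincidences a b c d = of_bool (s^2 = s + 1)"
    using sum_coincidences_mult[OF \<open>0 < a\<close>, of 1 s "s^2" "s^3"] powers_0123(2-)
    by (simp add: sum_coincidences_0123)
  moreover have "s = r"
    using powers_0123(1) \<open>r = d / c\<close> by simp
  ultimately show ?thesis
    by simp
next
  case (powers_0124 s)
  then show ?thesis
    using sum_coincidences_mult[OF \<open>0 < a\<close>, of 1 s "s^2" "s^4"]
    by (simp add: sum_coincidences_0124)
next
  case (powers_0234 s)
  have "sum_coincidences a b c d =
      of_bool (s^2 = s + 1) + of_bool (s^3 = s + 1) + of_bool (s^3 = s^2 + s + 1)"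
    using sum_coincidences_mult[OF \<open>0 < a\<close>, of 1 "s^2" "s^3" "s^4"] powers_0234(2-)
    by (simp add: sum_coincidences_0234)
  moreover have "s = r"
    using powers_0234(1) \<open>r = d / c\<close> by simp
  \<comment> \<open>This value lies strictly between \<open>r + 1\<close> and
    \<open>r^2 + r + 1\<close>, so the quadratic excludes both cubics. The cubics exclude each other
    because \<open>r^2 > 0\<close>.\<close>
  moreover have "r^3 = r^2 + r" if "r^2 = r + 1"
    using that by algebra
  moreover have "0 < r^2" "1 < r"
    using \<open>1 < s\<close> \<open>s = r\<close> by simp_all
  ultimately show ?thesis
    by auto
qed

section \<open>Irrationality of the roots\<close>

lemma rational_gt_1_not_root:
  fixes r :: real
  assumes "r \<in> \<rat>" "1 < r"
  shows "\<not> (r^2 = r + 1 \<or> r^3 = r + 1 \<or> r^3 = r^2 + r + 1)"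
proof
  assume roots: "r^2 = r + 1 \<or> r^3 = r + 1 \<or> r^3 = r^2 + r + 1"
  obtain p q :: int where pq: "0 < q" "coprime p q" "r = of_int p / of_int q"
    using Rats_cases'[OF \<open>r \<in> \<rat>\<close>] by metis
  have p: "of_int p = r * of_int q"
    using pq by simp
  \<comment> \<open>All three polynomials have constant term \<open>-1\<close>, so the numerator divides a power of the
    denominator.\<close>
  have "p dvd q ^ 3"
    using roots
  proof (elim disjE)
    assume r: "r^2 = r + 1"
    \<comment> \<open>The quadratic gives \<open>q^2 = p * (p - q)\<close>; a further factor
      \<open>q\<close> matches the exponent of the cubic cases.\<close>
    have "(of_int q :: real) ^ 3 = of_int p * (of_int q * (of_int p - of_int q))"
      unfolding p using r by algebra
    then have "q ^ 3 = p * (q * (p - q))"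
      by (metis of_int_diff of_int_eq_iff of_int_mult of_int_power)
    then show ?thesis by simp
  next
    assume r: "r^3 = r + 1"
    have "(of_int q :: real) ^ 3 = of_int p * (of_int p ^ 2 - of_int q ^ 2)"
      unfolding p using r by algebra
    then have "q ^ 3 = p * (p ^ 2 - q ^ 2)"
      by (metis of_int_diff of_int_eq_iff of_int_mult of_int_power)
    then show ?thesis by simp
  next
    assume r: "r^3 = r^2 + r + 1"
    have "(of_int q :: real) ^ 3 = of_int p * (of_int p ^ 2 - of_int p * of_int q - of_int q ^ 2)"
      unfolding p using r by algebra
    then have "q ^ 3 = p * (p ^ 2 - p * q - q ^ 2)"
      by (metis of_int_diff of_int_eq_iff of_int_mult of_int_power)
    then show ?thesis by simp
  qed
  moreover have "coprime p (q ^ 3)"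
    using pq by simp
  ultimately have "is_unit p"
    using coprime_common_divisor[of p "q ^ 3" p] by simp
  \<comment> \<open>With \<open>0 < q\<close> this forces \<open>p\<close> to be at least 2, so
    \<open>p\<close> is no unit.\<close>
  moreover have "q < p"
    using pq \<open>1 < r\<close> by simp
  ultimately show False
    using \<open>0 < q\<close> by auto
qed

section \<open>Realised and excluded pairs\<close>

lemma SPP_in_4_I:
  assumes "X \<subseteq> {0<..}" "a \<in> X" "b \<in> X" "c \<in> X" "d \<in> X" "a < b" "b < c" "c < d"
    and "i = 10 - sum_coincidences a b c d" "j = 10 - prod_coincidences a b c d"
  shows "(i, j) \<in> SPP_in X 4"
  using assms SPP_in_4[OF assms(1)] by blast

lemma pos_nats_pos_reals: "{real k |k. k > 0} \<subseteq> {0<..}"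
  by auto

lemma numeral_mem_pos_nats:
  "1 \<in> {real k |k. k > 0}" "numeral n \<in> {real k |k. k > 0}"
  by (auto intro: exI[of _ "1::nat"] exI[of _ "numeral n :: nat"])

lemma SPP_subset_SPP_pos_real: "SPP n \<subseteq> SPP_pos_real n"
  unfolding SPP_def SPP_pos_real_def SPP_in_def by fastforce

text \<open>If \<open>b\<close> is both the arithmetic and the geometric mean of \<open>a\<close>
  and \<open>c\<close>, then \<open>a = b\<close>; this excludes (5, 5).\<close>

lemma SPP_pos_real_3_subset: "SPP_pos_real 3 \<subseteq> {(5, 6), (6, 5), (6, 6)}"
proof -
  have "\<not> (a + c = b + b \<and> a * c = b * b)" if "a < b" for a b c :: real
  proof
    assume *: "a + c = b + b \<and> a * c = b * b"
    then have "(b - a) * (b - a) = 0" by algebra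
    with that show False by simp
  qed
  then show ?thesis
    unfolding SPP_pos_real_def by (subst SPP_in_3) (auto split: if_splits)
qed

lemma SPP_3_supset: "{(5, 6), (6, 5), (6, 6)} \<subseteq> SPP 3"
proof -
  have "p \<in> SPP 3" if "p = (6 - of_bool (a + c = b + b), 6 - of_bool (a * c = b * b))"
    "a \<in> {real k |k. k > 0}" "b \<in> {real k |k. k > 0}" "c \<in> {real k |k. k > 0}" "a < b" "b < c"
    for p a b c
    unfolding SPP_def SPP_in_3[OF pos_nats_pos_reals] using that by blast
  \<comment> \<open>The variables are instantiated in the order \<open>p\<close>, \<open>a\<close>,
    \<open>c\<close>, \<open>b\<close>, giving the sets {1, 2, 3} (arithmetic), {1, 2, 4}
    (geometric) and {1, 2, 5} (neither).\<close>
  from this[of _ 1 3 2] this[of _ 1 4 2] this[of _ 1 5 2] show ?thesis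
    using numeral_mem_pos_nats by auto
qed

lemma SPP_4_supset:
  "{(i, j). 7 \<le> i \<and> i \<le> 10 \<and> 9 \<le> j \<and> j \<le> 10} \<union> {(10, 7), (10, 8)} \<subseteq> SPP 4"
proof -
  note I = SPP_in_4_I[OF pos_nats_pos_reals, folded SPP_def]
    and coincidences = sum_coincidences_def prod_coincidences_def
  have "(7, 9) \<in> SPP 4"
    by (rule I[of 1 2 3 4], (rule numeral_mem_pos_nats)+) (simp_all add: coincidences)
  moreover have "(7, 10) \<in> SPP 4"
    by (rule I[of 2 3 4 5], (rule numeral_mem_pos_nats)+) (simp_all add: coincidences)
  moreover have "(8, 9) \<in> SPP 4"
    by (rule I[of 2 3 4 6], (rule numeral_mem_pos_nats)+) (simp_all add: coincidences)
  moreover have "(8, 10) \<in> SPP 4"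
    by (rule I[of 1 2 3 5], (rule numeral_mem_pos_nats)+) (simp_all add: coincidences)
  moreover have "(9, 9) \<in> SPP 4"
    by (rule I[of 1 2 4 5], (rule numeral_mem_pos_nats)+) (simp_all add: coincidences)
  moreover have "(9, 10) \<in> SPP 4"
    by (rule I[of 1 2 5 6], (rule numeral_mem_pos_nats)+) (simp_all add: coincidences)
  moreover have "(10, 9) \<in> SPP 4"
    by (rule I[of 2 4 7 8], (rule numeral_mem_pos_nats)+) (simp_all add: coincidences)
  moreover have "(10, 10) \<in> SPP 4"
    by (rule I[of 1 2 5 7], (rule numeral_mem_pos_nats)+) (simp_all add: coincidences)
  \<comment> \<open>Powers of 2 with exponents 0, 1, 2, 3 and 0, 1, 2, 4 have three and two product
    coincidences.\<close>
  moreover have "(10, 7) \<in> SPP 4"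
    by (rule I[of 1 2 4 8], (rule numeral_mem_pos_nats)+) (simp_all add: coincidences)
  moreover have "(10, 8) \<in> SPP 4"
    by (rule I[of 1 2 4 16], (rule numeral_mem_pos_nats)+) (simp_all add: coincidences)
  moreover have "i = 7 \<or> i = 8 \<or> i = 9 \<or> i = 10" if "7 \<le> i" "i \<le> 10" for i :: nat
    using that by arith
  moreover have "j = 9 \<or> j = 10" if "9 \<le> j" "j \<le> 10" for j :: nat
    using that by arith
  ultimately show ?thesis
    by blast
qed

text \<open>The parameter \<open>m\<close> isolates the difference between the two settings: 0
  serves for integers and 1 for reals.\<close>

lemma SPP_in_4_subset:
  assumes "X \<subseteq> {0<..}"
    and sum_le: "\<And>a b c d. \<lbrakk>a \<in> X; b \<in> X; c \<in> X; d \<in> X; a < b; b < c; c < d;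
      2 \<le> prod_coincidences a b c d\<rbrakk> \<Longrightarrow> sum_coincidences a b c d \<le> m"
  shows "SPP_in X 4 \<subseteq> {(i, j). 7 \<le> i \<and> i \<le> 10 \<and> 9 \<le> j \<and> j \<le> 10} \<union>
    {10 - m..10} \<times> {7, 8}"
proof
  fix p assume "p \<in> SPP_in X 4"
  then obtain a b c d
    where p: "p = (10 - sum_coincidences a b c d, 10 - prod_coincidences a b c d)"
    and abcd: "a \<in> X" "b \<in> X" "c \<in> X" "d \<in> X" "a < b" "b < c" "c < d"
    unfolding SPP_in_4[OF assms(1)] by blast
  have "0 < a"
    using abcd assms(1) by auto
  have "sum_coincidences a b c d \<le> 3" "prod_coincidences a b c d \<le> 3"
    using abcd \<open>0 < a\<close> sum_coincidences_le_3[of "ln a" "ln b" "ln c" "ln d"]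
    by (simp_all add: sum_coincidences_le_3 prod_coincidences_eq_sum_coincidences_ln)
  then show "p \<in> {(i, j). 7 \<le> i \<and> i \<le> 10 \<and> 9 \<le> j \<and> j \<le> 10} \<union> {10 - m..10} \<times> {7, 8}"
    using sum_le[OF abcd]
    by (cases "2 \<le> prod_coincidences a b c d") (auto simp: p)
qed

lemma SPP_4_subset:
  "SPP 4 \<subseteq> {(i, j). 7 \<le> i \<and> i \<le> 10 \<and> 9 \<le> j \<and> j \<le> 10} \<union> {(10, 7), (10, 8)}"
proof -
  have "sum_coincidences a b c d \<le> 0"
    if "a \<in> {real k |k. k > 0}" "b \<in> {real k |k. k > 0}" "c \<in> {real k |k. k > 0}"
      "d \<in> {real k |k. k > 0}" "a < b" "b < c" "c < d" "2 \<le> prod_coincidences a b c d"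
    for a b c d
  proof -
    \<comment> \<open>Integrality enters here: a rational ratio is never one of the roots, which
      leaves no sum coincidence.\<close>
    have "d / c \<in> \<rat>" "1 < d / c"
      using that by auto
    moreover have "0 < a"
      using that by auto
    ultimately show ?thesis
      using that(5-8) prod_coincidences_ge_2_imp[of a b c d "d / c"] rational_gt_1_not_root[of "d / c"]
      by simp
  qed
  from SPP_in_4_subset[OF pos_nats_pos_reals this] show ?thesis
    by (auto simp: SPP_def)
qed

lemma SPP_pos_real_4_subset:
  "SPP_pos_real 4 \<subseteq> {(i, j). 7 \<le> i \<and> i \<le> 10 \<and> 9 \<le> j \<and> j \<le> 10} \<union>
    {(10, 7), (10, 8), (9, 7), (9, 8)}"
proof -
  have "{x :: real. x > 0} \<subseteq> {0<..}"
    by auto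
  moreover have "sum_coincidences a b c d \<le> 1"
    if "0 < a" "a < b" "b < c" "c < d" "2 \<le> prod_coincidences a b c d" for a b c d
    using prod_coincidences_ge_2_imp[OF that refl] by auto
  ultimately
  have "SPP_pos_real 4 \<subseteq> {(i, j). 7 \<le> i \<and> i \<le> 10 \<and> 9 \<le> j \<and> j \<le> 10} \<union> {9..10} \<times> {7, 8}"
    using SPP_in_4_subset[of "{x. x > 0}" 1] by (simp add: SPP_pos_real_def)
  moreover have "{9..10} = {9, 10 :: nat}"
    by auto
  ultimately show ?thesis
    by auto
qed

text \<open>In both {1, r, r^2, r^3} and {1, r^2, r^3, r^4} the single sum coincidence is
  \<open>1 + r^3 = r^2 + r^2\<close>, which holds for the golden ratio.\<close>

lemma golden_ratio_SPP_pos_real: "{(9, 7), (9, 8)} \<subseteq> SPP_pos_real 4"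
proof -
  define r :: real where "r = (1 + sqrt 5) / 2"
  have "1 < r"
    unfolding r_def by simp
  have r: "r^2 = r + 1"
    by (simp add: r_def power2_eq_square field_simps)
  have pow: "r ^ i = r ^ j \<longleftrightarrow> i = j" "r ^ i < r ^ j \<longleftrightarrow> i < j" for i j
    using \<open>1 < r\<close> by simp_all
  have "r^3 = r^2 + r"
    using r by algebra
  then have cube: "r^3 \<noteq> r + 1" "r^3 \<noteq> r^2 + r + 1"
    using r \<open>1 < r\<close> by auto
  note I = SPP_in_4_I[of "{x. x > 0}", folded SPP_pos_real_def]
  \<comment> \<open>Writing every element as a power turns product equations into equations between
    exponents.\<close>
  have "prod_coincidences (r^0) (r^1) (r^2) (r^3) = 3" "prod_coincidences (r^0) (r^2) (r^3) (r^4) = 2"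
    unfolding prod_coincidences_def power_add[symmetric] pow by simp_all
  then have prod: "prod_coincidences 1 r (r^2) (r^3) = 3" "prod_coincidences 1 (r^2) (r^3) (r^4) = 2"
    by simp_all
  have sum: "sum_coincidences 1 r (r^2) (r^3) = 1" "sum_coincidences 1 (r^2) (r^3) (r^4) = 1"
    using sum_coincidences_0123[OF \<open>1 < r\<close>] sum_coincidences_0234[OF \<open>1 < r\<close>] r cube by simp_all
  have "1 < r^2" "r < r^2" "r^2 < r^3" "r^3 < r^4"
    using pow(2)[of 0 2] pow(2)[of 1 2] pow(2)[of 2 3] pow(2)[of 3 4] by simp_all
  then have "(9, 7) \<in> SPP_pos_real 4" "(9, 8) \<in> SPP_pos_real 4"
    using I[of 1 r "r^2" "r^3" 9 7] I[of 1 "r^2" "r^3" "r^4" 9 8] \<open>1 < r\<close>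
    unfolding sum prod by (simp_all add: greaterThan_def)
  then show ?thesis
    by simp
qed

theorem theorem5:
  shows "SPP_pos_real 1 = SPP 1 \<and> SPP 1 = {(1, 1)} \<and>
    SPP_pos_real 2 = SPP 2 \<and> SPP 2 = {(3, 3)} \<and>
    SPP_pos_real 3 = SPP 3 \<and> SPP 3 = {(5, 6), (6, 5), (6, 6)} \<and>
    SPP 4 = {(i, j). 7 \<le> i \<and> i \<le> 10 \<and> 9 \<le> j \<and> j \<le> 10} \<union> {(10, 7), (10, 8)} \<and>
    SPP_pos_real 4 = SPP 4 \<union> {(9, 7), (9, 8)}"
proof -
  have "SPP 1 = {(1, 1)}"
    unfolding SPP_def by (rule SPP_in_1, rule numeral_mem_pos_nats)
  moreover have "SPP_pos_real 1 = {(1, 1)}"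
    unfolding SPP_pos_real_def by (rule SPP_in_1[of 1]) simp
  moreover have "SPP 2 = {(3, 3)}"
    unfolding SPP_def
    by (rule SPP_in_2[of _ 1 2], rule pos_nats_pos_reals, (rule numeral_mem_pos_nats)+) simp
  moreover have "SPP_pos_real 2 = {(3, 3)}"
    unfolding SPP_pos_real_def by (rule SPP_in_2[of _ 1 2]) auto
  moreover have "SPP_pos_real 3 = SPP 3" "SPP 3 = {(5, 6), (6, 5), (6, 6)}"
    using SPP_pos_real_3_subset SPP_3_supset SPP_subset_SPP_pos_real[of 3] by blast+
  moreover have SPP_4:
    "SPP 4 = {(i, j). 7 \<le> i \<and> i \<le> 10 \<and> 9 \<le> j \<and> j \<le> 10} \<union> {(10, 7), (10, 8)}"
    using SPP_4_subset SPP_4_supset by (rule equalityI)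
  moreover have "SPP_pos_real 4 = SPP 4 \<union> {(9, 7), (9, 8)}"
    using SPP_pos_real_4_subset golden_ratio_SPP_pos_real SPP_subset_SPP_pos_real[of 4]
    unfolding SPP_4 by blast
  ultimately show ?thesis
    by simp
qed

end
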